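(* Let $\epsilon_1,\epsilon_2,\epsilon_3,\epsilon_a,\epsilon_b,\epsilon_c,\epsilon_d$ be i.i.d. symmetric Rademacher random variables (uniform on $\{-1,1\}$). Define $$Q_\triangle:=\epsilon_1\epsilon_2+\epsilon_1\epsilon_3+\epsilon_2\epsilon_3,\qquad Q_\square:=\epsilon_a\epsilon_b+\epsilon_b\epsilon_c+\epsilon_c\epsilon_d+\epsilon_d\epsilon_a .$$ Take four independent copies $Q_{\triangle,1},\dots,Q_{\triangle,4}$ of $Q_\triangle$ and three independent copies $Q_{\square,1},Q_{\square,2},Q_{\square,3}$ of $Q_\square$ (all seven independent, built on disjoint sets of i.i.d. symmetric Rademacher variables), and set $$F:=\sum_{j=1}^4Q_{\triangle,j}+\sum_{j=1}^3Q_{\square,j}.$$ Then $F$ belongs to the second Rademacher chaos and satisfies $$\frac{F+24}{2}\in\mathbb N_0\qquad\text{and}\qquad\mathbb E[(F+24)^k]=\mathbb E[P_{24}^k],\quad1\le k\le4,$$ where $P_{24}\sim\mathrm{Poisson}(24)$. Moreover, $$d_{\mathrm{TV}}\big(F+24,P_{24}\big)\ge\frac{1-e^{-48}}2 .$$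
   Context: $\mathbb N_0=\{0,1,2,\dots\}$. For $\mathbb N_0$-valued random variables, $d_{\mathrm{TV}}(X,Y)=\sup_{A\subseteq\mathbb N_0}|\mathbb P(X\in A)-\mathbb P(Y\in A)|$. The second Rademacher chaos over a sequence $(Y_k)_{k\ge1}$ of i.i.d. symmetric Rademacher variables is the set of all $\sum_{i,j}f(i,j)Y_iY_j$ with $f:\mathbb N^2\to\mathbb R$ symmetric, square-summable and vanishing on the diagonal. *)

theory Defs
  imports "HOL-Probability.Probability"
begin

definition rademacher :: "'w measure \<Rightarrow> ('w \<Rightarrow> real) \<Rightarrow> bool" where
  "rademacher M X \<longleftrightarrow> X \<in> borel_measurable M \<and>
     measure M {\<omega> \<in> space M. X \<omega> = 1} = 1 / 2 \<and>
     measure M {\<omega> \<in> space M. X \<omega> = -1} = 1 / 2"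

definition iid_rademacher :: "'w measure \<Rightarrow> (nat \<Rightarrow> 'w \<Rightarrow> real) \<Rightarrow> bool" where
  "iid_rademacher M Y \<longleftrightarrow> prob_space M \<and>
     prob_space.indep_vars M (\<lambda>_. borel) Y UNIV \<and> (\<forall>k. rademacher M (Y k))"

text \<open>The series over all pairs \<open>(i, j)\<close> is understood as an unconditional sum in the mean square:
  the limit is along the net of finite sets of pairs. It is taken with the nonnegative integral, so
  that a difference that is not square-integrable has distance infinity, not 0. The index set of
  the sequence is all of \<open>nat\<close>, i.e. numbering starts at 0.\<close>

definition second_rademacher_chaos ::
    "'w measure \<Rightarrow> (nat \<Rightarrow> 'w \<Rightarrow> real) \<Rightarrow> ('w \<Rightarrow> real) set" where
  "second_rademacher_chaos M Y =
     {X \<in> borel_measurable M. \<exists>f :: nat \<Rightarrow> nat \<Rightarrow> real.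
        (\<forall>i j. f i j = f j i) \<and>
        (\<lambda>(i, j). (f i j)\<^sup>2) summable_on UNIV \<and>
        (\<forall>i. f i i = 0) \<and>
        ((\<lambda>S. \<integral>\<^sup>+ \<omega>. ennreal ((X \<omega> - (\<Sum>(i, j)\<in>S. f i j * Y i \<omega> * Y j \<omega>))\<^sup>2) \<partial>M)
           \<longlongrightarrow> 0) (finite_subsets_at_top UNIV)}"

definition Q_triangle :: "('w \<Rightarrow> real) \<Rightarrow> ('w \<Rightarrow> real) \<Rightarrow> ('w \<Rightarrow> real) \<Rightarrow> 'w \<Rightarrow> real" where
  "Q_triangle e1 e2 e3 \<omega> = e1 \<omega> * e2 \<omega> + e1 \<omega> * e3 \<omega> + e2 \<omega> * e3 \<omega>"

definition Q_square ::
    "('w \<Rightarrow> real) \<Rightarrow> ('w \<Rightarrow> real) \<Rightarrow> ('w \<Rightarrow> real) \<Rightarrow> ('w \<Rightarrow> real) \<Rightarrow> 'w \<Rightarrow> real" where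
  "Q_square ea eb ec ed \<omega> = ea \<omega> * eb \<omega> + eb \<omega> * ec \<omega> + ec \<omega> * ed \<omega> + ed \<omega> * ea \<omega>"

text \<open>The seven blocks are built on members of one sequence \<open>Y\<close>: \<open>t j i\<close> is the index of the
  \<open>i\<close>-th variable of the \<open>j\<close>-th triangle, \<open>s j i\<close> that of the \<open>i\<close>-th variable of the \<open>j\<close>-th square
  (in cyclic order). For an i.i.d. sequence, distinctness of all 24 indices makes the seven blocks
  independent copies.\<close>

definition disjoint_blocks :: "(nat \<Rightarrow> nat \<Rightarrow> nat) \<Rightarrow> (nat \<Rightarrow> nat \<Rightarrow> nat) \<Rightarrow> bool" where
  "disjoint_blocks t s \<longleftrightarrow>
     inj_on (\<lambda>(j, i). t j i) ({1..4} \<times> {1..3}) \<and>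
     inj_on (\<lambda>(j, i). s j i) ({1..3} \<times> {1..4}) \<and>
     (\<lambda>(j, i). t j i) ` ({1..4} \<times> {1..3}) \<inter> (\<lambda>(j, i). s j i) ` ({1..3} \<times> {1..4}) = {}"

definition F_chaos ::
    "(nat \<Rightarrow> 'w \<Rightarrow> real) \<Rightarrow> (nat \<Rightarrow> nat \<Rightarrow> nat) \<Rightarrow> (nat \<Rightarrow> nat \<Rightarrow> nat) \<Rightarrow> 'w \<Rightarrow> real" where
  "F_chaos Y t s \<omega> =
     (\<Sum>j = 1..4. Q_triangle (Y (t j 1)) (Y (t j 2)) (Y (t j 3)) \<omega>) +
     (\<Sum>j = 1..3. Q_square (Y (s j 1)) (Y (s j 2)) (Y (s j 3)) (Y (s j 4)) \<omega>)"

text \<open>Total variation distance of two (almost surely) \<open>\<nat>\<close>-valued random variables, which may live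
  on different probability spaces and are regarded as real-valued.\<close>

definition d_TV :: "'w measure \<Rightarrow> ('w \<Rightarrow> real) \<Rightarrow> 'v measure \<Rightarrow> ('v \<Rightarrow> real) \<Rightarrow> real" where
  "d_TV M X N Z =
     (SUP A \<in> Pow \<nat>. \<bar>measure M {\<omega> \<in> space M. X \<omega> \<in> A} - measure N {\<omega> \<in> space N. Z \<omega> \<in> A}\<bar>)"

definition poisson_distributed :: "'v measure \<Rightarrow> ('v \<Rightarrow> nat) \<Rightarrow> real \<Rightarrow> bool" where
  "poisson_distributed N P lam \<longleftrightarrow> prob_space N \<and> P \<in> measurable N (count_space UNIV) \<and>
     distr N (count_space UNIV) P = measure_pmf (poisson_pmf lam)"

end

theory Submission
  imports Defs
begin

text \<open>
  Cumulants of independent summands add, so the coincidence of moments is a small linear problem.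
  All cumulants of a Poisson variable equal its parameter. A triangle takes the value \<open>3\<close> with
  probability \<open>1/4\<close> and \<open>-1\<close> otherwise; its cumulants of orders 2, 3, 4 are \<open>3, 6, -6\<close>. A square
  factors as \<open>(\<epsilon>\<^sub>a + \<epsilon>\<^sub>c) (\<epsilon>\<^sub>b + \<epsilon>\<^sub>d)\<close>, takes the values \<open>0, 4, -4\<close>, and has cumulants
  \<open>4, 0, 16\<close>. Four triangles and three squares therefore give \<open>24, 24, 24\<close>, which are those of
  the centred Poisson variable of parameter 24 (\<open>has_cumulants_F_chaos\<close>). On the Poisson side the
  raw moments come from the identity \<open>E[P g(P)] = lam E[g(P + 1)]\<close> (\<open>poisson_stein_chen\<close>).

  Matching moments do not bring the laws close, because of parity. Up to an additive constant
  every block takes values in the multiples of 4, and this makes \<open>F + 24\<close> an even natural number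
  almost surely (\<open>F_chaos_lattice\<close>). A Poisson variable is even only with probability
  \<open>(1 + exp (-2 lam)) / 2\<close>, so the set of even numbers already witnesses the lower bound on the total
  variation distance.

  Finally, \<open>F\<close> is a finite quadratic form without square terms, given by the edges of a graph,
  and hence lies in the second chaos: the partial sums are eventually equal to \<open>F\<close>
  (\<open>finite_form_in_chaos\<close>).
\<close>

section \<open>Finite quadratic forms in the second chaos\<close>

text \<open>The symmetric part \<open>(A + A\<^sup>T) / 2\<close> of the adjacency matrix of a directed multigraph: each edge is split evenly between its two orientations, as a symmetric kernel must do.\<close>
definition edge_weight :: "(nat \<times> nat) list \<Rightarrow> nat \<Rightarrow> nat \<Rightarrow> real" where
  "edge_weight es i j =
     (real (count_list es (i, j)) + real (count_list es (j, i))) / 2"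

lemma sum_edge_weight:
  fixes y :: "nat \<Rightarrow> real"
  assumes "finite S" "set es \<subseteq> S" "(\<lambda>(a, b). (b, a)) ` set es \<subseteq> S"
  shows "(\<Sum>(i, j)\<in>S. edge_weight es i j * y i * y j) = (\<Sum>(a, b)\<leftarrow>es. y a * y b)"
  using assms(2,3)
proof (induction es)
  case Nil
  show ?case by (simp add: edge_weight_def)
next
  case (Cons e es)
  obtain a b where e: "e = (a, b)" by (cases e)
  have single: "(\<Sum>(i, j)\<in>S. of_bool (i = a' \<and> j = b') * (y i * y j)) = y a' * y b'"
    if "(a', b') \<in> S" for a' b'
  proof -
    have "(\<Sum>(i, j)\<in>S. of_bool (i = a' \<and> j = b') * (y i * y j))
        = (\<Sum>p\<in>S. if p = (a', b') then y a' * y b' else 0)"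
      by (intro sum.cong) auto
    then show ?thesis using that assms(1) by simp
  qed
  have weight: "edge_weight (e # es) i j
      = of_bool (i = a \<and> j = b) / 2 + of_bool (i = b \<and> j = a) / 2 + edge_weight es i j" for i j
  proof -
    have "real (count_list (e # es) (i, j)) = of_bool (i = a \<and> j = b) + real (count_list es (i, j))"
      for i j by (auto simp: e)
    from this[of i j] this[of j i] show ?thesis
      unfolding edge_weight_def by (simp only: add_divide_distrib conj_commute add_ac)
  qed
  have "(\<Sum>(i, j)\<in>S. edge_weight (e # es) i j * y i * y j)
      = (\<Sum>(i, j)\<in>S. of_bool (i = a \<and> j = b) * (y i * y j)) / 2
      + (\<Sum>(i, j)\<in>S. of_bool (i = b \<and> j = a) * (y i * y j)) / 2
      + (\<Sum>(i, j)\<in>S. edge_weight es i j * y i * y j)"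
    unfolding sum_divide_distrib sum.distrib[symmetric]
    by (intro sum.cong refl) (simp add: weight case_prod_unfold distrib_right)
  also have "\<dots> = y a * y b / 2 + y b * y a / 2 + (\<Sum>(a, b)\<leftarrow>es. y a * y b)"
    using Cons e by (subst (1 2) single) auto
  finally show ?case by (simp add: e)
qed

text \<open>The kernel \<open>edge_weight es\<close> has finite support, and every partial sum over a finite set of
  pairs that contains the support is pointwise equal to the form. So the mean square distance in
  the definition of the chaos is eventually zero along the net of finite sets.\<close>
lemma finite_form_in_chaos:
  assumes Y: "\<And>k. Y k \<in> borel_measurable M"
    and loopfree: "\<And>a b. (a, b) \<in> set es \<Longrightarrow> a \<noteq> b"
  shows "(\<lambda>\<omega>. \<Sum>(a, b)\<leftarrow>es. Y a \<omega> * Y b \<omega>) \<in> second_rademacher_chaos M Y"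
proof -
  let ?X = "\<lambda>\<omega>. \<Sum>(a, b)\<leftarrow>es. Y a \<omega> * Y b \<omega>"
  let ?S = "set es \<union> (\<lambda>(a, b). (b, a)) ` set es"
  have sym: "edge_weight es i j = edge_weight es j i" for i j
    by (simp add: edge_weight_def)
  have zero: "edge_weight es i j = 0" if "(i, j) \<notin> ?S" for i j
  proof -
    from that have "(i, j) \<notin> set es" "(j, i) \<notin> set es" by force+
    then show ?thesis by (simp add: edge_weight_def count_list_0_iff)
  qed
  have meas: "?X \<in> borel_measurable M"
    using Y by (induction es) (auto simp: case_prod_unfold)
  have "(\<lambda>(i, j). (edge_weight es i j)\<^sup>2) summable_on UNIV \<longleftrightarrow>
      (\<lambda>(i, j). (edge_weight es i j)\<^sup>2) summable_on ?S"
    using zero by (intro summable_on_cong_neutral) auto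
  then have summ: "(\<lambda>(i, j). (edge_weight es i j)\<^sup>2) summable_on UNIV"
    by simp
  have "\<forall>\<^sub>F S in finite_subsets_at_top UNIV.
      (\<integral>\<^sup>+ \<omega>. ennreal ((?X \<omega> - (\<Sum>(i, j)\<in>S. edge_weight es i j * Y i \<omega> * Y j \<omega>))\<^sup>2) \<partial>M) = 0"
    unfolding eventually_finite_subsets_at_top
  proof (intro exI[of _ ?S] conjI allI impI)
    fix S assume "finite S \<and> ?S \<subseteq> S \<and> S \<subseteq> (UNIV :: (nat \<times> nat) set)"
    then have "(\<Sum>(i, j)\<in>S. edge_weight es i j * Y i \<omega> * Y j \<omega>) = ?X \<omega>" for \<omega>
      by (intro sum_edge_weight) auto
    then show "(\<integral>\<^sup>+ \<omega>. ennreal ((?X \<omega> - (\<Sum>(i, j)\<in>S. edge_weight es i j * Y i \<omega> * Y j \<omega>))\<^sup>2) \<partial>M) = 0"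
      by simp
  qed auto
  then have lim: "((\<lambda>S. \<integral>\<^sup>+ \<omega>. ennreal ((?X \<omega> -
      (\<Sum>(i, j)\<in>S. edge_weight es i j * Y i \<omega> * Y j \<omega>))\<^sup>2) \<partial>M) \<longlongrightarrow> 0) (finite_subsets_at_top UNIV)"
    by (rule tendsto_eventually)
  have diag: "edge_weight es i i = 0" for i
    using loopfree by (intro zero) auto
  show ?thesis
    unfolding second_rademacher_chaos_def mem_Collect_eq
    using meas sym summ diag lim by (intro conjI exI[of _ "edge_weight es"]) auto
qed

definition block_edges :: "(nat \<Rightarrow> nat \<Rightarrow> nat) \<Rightarrow> (nat \<Rightarrow> nat \<Rightarrow> nat) \<Rightarrow> (nat \<times> nat) list" where
  "block_edges t s =
     concat (map (\<lambda>j. [(t j 1, t j 2), (t j 1, t j 3), (t j 2, t j 3)]) [1..<5]) @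
     concat (map (\<lambda>j. [(s j 1, s j 2), (s j 2, s j 3), (s j 3, s j 4), (s j 4, s j 1)]) [1..<4])"

lemma F_chaos_eq_form: "F_chaos Y t s = (\<lambda>\<omega>. \<Sum>(a, b)\<leftarrow>block_edges t s. Y a \<omega> * Y b \<omega>)"
proof -
  have "[1..<5] = [1, 2, 3, 4 :: nat]" "[1..<4] = [1, 2, 3 :: nat]"
    by (simp_all add: upt_rec)
  moreover have "{1..4} = {1, 2, 3, 4 :: nat}" "{1..3} = {1, 2, 3 :: nat}"
    by auto
  ultimately show ?thesis
    by (simp add: fun_eq_iff F_chaos_def block_edges_def Q_triangle_def Q_square_def algebra_simps)
qed

text \<open>Disjointness of the blocks in a form that decides equations between vertex indices.\<close>
lemma disjoint_blocksD:
  assumes "disjoint_blocks t s"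
  shows "\<lbrakk>j \<in> {1..4}; j' \<in> {1..4}; i \<in> {1..3}; i' \<in> {1..3}\<rbrakk> \<Longrightarrow> t j i = t j' i' \<longleftrightarrow> j = j' \<and> i = i'"
    and "\<lbrakk>j \<in> {1..3}; j' \<in> {1..3}; i \<in> {1..4}; i' \<in> {1..4}\<rbrakk> \<Longrightarrow> s j i = s j' i' \<longleftrightarrow> j = j' \<and> i = i'"
    and "\<lbrakk>j \<in> {1..4}; j' \<in> {1..3}; i \<in> {1..3}; i' \<in> {1..4}\<rbrakk> \<Longrightarrow> t j i \<noteq> s j' i'"
proof -
  note d = assms[unfolded disjoint_blocks_def]
  show "\<lbrakk>j \<in> {1..4}; j' \<in> {1..4}; i \<in> {1..3}; i' \<in> {1..3}\<rbrakk> \<Longrightarrow> t j i = t j' i' \<longleftrightarrow> j = j' \<and> i = i'"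
    using inj_onD[OF d[THEN conjunct1], of "(j, i)" "(j', i')"] by auto
  show "\<lbrakk>j \<in> {1..3}; j' \<in> {1..3}; i \<in> {1..4}; i' \<in> {1..4}\<rbrakk> \<Longrightarrow> s j i = s j' i' \<longleftrightarrow> j = j' \<and> i = i'"
    using inj_onD[OF d[THEN conjunct2, THEN conjunct1], of "(j, i)" "(j', i')"] by auto
  show "\<lbrakk>j \<in> {1..4}; j' \<in> {1..3}; i \<in> {1..3}; i' \<in> {1..4}\<rbrakk> \<Longrightarrow> t j i \<noteq> s j' i'"
    using d[THEN conjunct2, THEN conjunct2] by (auto simp: set_eq_iff image_iff) (metis atLeastAtMost_iff)
qed

lemma F_chaos_in_chaos:
  assumes "\<And>k. Y k \<in> borel_measurable M" "disjoint_blocks t s"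
  shows "F_chaos Y t s \<in> second_rademacher_chaos M Y"
  unfolding F_chaos_eq_form
  using assms(1)
proof (rule finite_form_in_chaos)
  fix a b assume "(a, b) \<in> set (block_edges t s)"
  then obtain j where "j \<in> {1..4} \<and> (a, b) \<in> {(t j 1, t j 2), (t j 1, t j 3), (t j 2, t j 3)} \<or>
      j \<in> {1..3} \<and> (a, b) \<in> {(s j 1, s j 2), (s j 2, s j 3), (s j 3, s j 4), (s j 4, s j 1)}"
    unfolding block_edges_def by fastforce
  then show "a \<noteq> b"
    using disjoint_blocksD(1,2)[OF assms(2), of j j] by auto
qed

section \<open>Additivity of cumulants\<close>

text \<open>The numbers \<open>k2\<close>, \<open>k3\<close>, \<open>k4\<close> are the cumulants of orders 2, 3, 4 of a centred variable: the
  second and third coincide with the moments, and the fourth is \<open>E[X\<^sup>4] - 3 E[X\<^sup>2]\<^sup>2\<close>. Stating this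
  with \<open>has_bochner_integral\<close> carries integrability of the four powers along.\<close>
definition has_cumulants :: "'w measure \<Rightarrow> ('w \<Rightarrow> real) \<Rightarrow> real \<Rightarrow> real \<Rightarrow> real \<Rightarrow> bool" where
  "has_cumulants M X k2 k3 k4 \<longleftrightarrow>
     has_bochner_integral M X 0 \<and>
     has_bochner_integral M (\<lambda>\<omega>. X \<omega> ^ 2) k2 \<and>
     has_bochner_integral M (\<lambda>\<omega>. X \<omega> ^ 3) k3 \<and>
     has_bochner_integral M (\<lambda>\<omega>. X \<omega> ^ 4) (k4 + 3 * k2\<^sup>2)"

lemma (in prob_space) has_bochner_integral_indep_powers:
  fixes X Z :: "'a \<Rightarrow> real"
  assumes "indep_var borel X borel Z"
    and "has_bochner_integral M (\<lambda>\<omega>. X \<omega> ^ i) a" "has_bochner_integral M (\<lambda>\<omega>. Z \<omega> ^ j) b"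
  shows "has_bochner_integral M (\<lambda>\<omega>. X \<omega> ^ i * Z \<omega> ^ j) (a * b)"
proof -
  have "indep_var borel (\<lambda>\<omega>. X \<omega> ^ i) borel (\<lambda>\<omega>. Z \<omega> ^ j)"
    using indep_var_compose[OF assms(1), of "\<lambda>x. x ^ i" borel "\<lambda>x. x ^ j" borel]
    by (simp add: comp_def)
  with assms(2,3) show ?thesis
    by (simp add: has_bochner_integral_iff indep_var_lebesgue_integral indep_var_integrable)
qed

text \<open>In the binomial expansion of \<open>E[(X + Z)\<^sup>n]\<close> every mixed term with a first power vanishes, as
  both variables are centred. For \<open>n \<le> 3\<close> no mixed term survives. For \<open>n = 4\<close> the only survivor is
  \<open>6 k2 l2\<close>, and it is exactly the cross term in \<open>3 (k2 + l2)\<^sup>2\<close>; this is why the fourth cumulant,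
  and not the fourth moment, is additive.\<close>
lemma (in prob_space) has_cumulants_add:
  fixes X Z :: "'a \<Rightarrow> real"
  assumes ind: "indep_var borel X borel Z"
    and X: "has_cumulants M X k2 k3 k4" and Z: "has_cumulants M Z l2 l3 l4"
  shows "has_cumulants M (\<lambda>\<omega>. X \<omega> + Z \<omega>) (k2 + l2) (k3 + l3) (k4 + l4)"
proof -
  note X' = X[unfolded has_cumulants_def] and Z' = Z[unfolded has_cumulants_def]
  note mixed = has_bochner_integral_indep_powers[OF ind]
  have X1: "has_bochner_integral M (\<lambda>\<omega>. X \<omega> ^ 1) 0" and Z1: "has_bochner_integral M (\<lambda>\<omega>. Z \<omega> ^ 1) 0"
    using X' Z' by simp_all
  have 1: "has_bochner_integral M (\<lambda>\<omega>. X \<omega> + Z \<omega>) (0 + 0)"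
    using X' Z' by (intro has_bochner_integral_add) auto
  have 2: "has_bochner_integral M (\<lambda>\<omega>. X \<omega> ^ 2 + 2 * (X \<omega> ^ 1 * Z \<omega> ^ 1) + Z \<omega> ^ 2)
      (k2 + 2 * (0 * 0) + l2)"
    using X' Z' by (intro has_bochner_integral_add has_bochner_integral_mult_right mixed X1 Z1) auto
  have 3: "has_bochner_integral M
      (\<lambda>\<omega>. X \<omega> ^ 3 + 3 * (X \<omega> ^ 2 * Z \<omega> ^ 1) + 3 * (X \<omega> ^ 1 * Z \<omega> ^ 2) + Z \<omega> ^ 3)
      (k3 + 3 * (k2 * 0) + 3 * (0 * l2) + l3)"
    using X' Z' by (intro has_bochner_integral_add has_bochner_integral_mult_right mixed X1 Z1) auto
  have 4: "has_bochner_integral M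
      (\<lambda>\<omega>. X \<omega> ^ 4 + 4 * (X \<omega> ^ 3 * Z \<omega> ^ 1) + 6 * (X \<omega> ^ 2 * Z \<omega> ^ 2)
           + 4 * (X \<omega> ^ 1 * Z \<omega> ^ 3) + Z \<omega> ^ 4)
      ((k4 + 3 * k2\<^sup>2) + 4 * (k3 * 0) + 6 * (k2 * l2) + 4 * (0 * l3) + (l4 + 3 * l2\<^sup>2))"
    using X' Z' by (intro has_bochner_integral_add has_bochner_integral_mult_right mixed X1 Z1) auto
  show ?thesis
    unfolding has_cumulants_def
  proof (intro conjI)
    show "has_bochner_integral M (\<lambda>\<omega>. X \<omega> + Z \<omega>) 0"
      using 1 by simp
    show "has_bochner_integral M (\<lambda>\<omega>. (X \<omega> + Z \<omega>) ^ 2) (k2 + l2)"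
      using 2 by (simp add: power2_eq_square algebra_simps)
    show "has_bochner_integral M (\<lambda>\<omega>. (X \<omega> + Z \<omega>) ^ 3) (k3 + l3)"
      using 3 by (simp add: power3_eq_cube power2_eq_square algebra_simps)
    show "has_bochner_integral M (\<lambda>\<omega>. (X \<omega> + Z \<omega>) ^ 4) (k4 + l4 + 3 * (k2 + l2)\<^sup>2)"
      using 4 by (simp add: power4_eq_xxxx power3_eq_cube power2_eq_square algebra_simps)
  qed
qed

lemma (in prob_space) has_cumulants_sum:
  fixes X :: "'i \<Rightarrow> 'a \<Rightarrow> real"
  assumes "finite I" "indep_vars (\<lambda>_. borel) X I"
    and "\<And>i. i \<in> I \<Longrightarrow> has_cumulants M (X i) (k2 i) (k3 i) (k4 i)"
  shows "has_cumulants M (\<lambda>\<omega>. \<Sum>i\<in>I. X i \<omega>) (\<Sum>i\<in>I. k2 i) (\<Sum>i\<in>I. k3 i) (\<Sum>i\<in>I. k4 i)"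
  using assms
proof (induction I rule: finite_induct)
  case empty
  show ?case by (simp add: has_cumulants_def has_bochner_integral_zero)
next
  case (insert i I)
  have "has_cumulants M (\<lambda>\<omega>. \<Sum>i\<in>I. X i \<omega>) (\<Sum>i\<in>I. k2 i) (\<Sum>i\<in>I. k3 i) (\<Sum>i\<in>I. k4 i)"
    using insert.prems by (intro insert.IH indep_vars_subset[OF insert.prems(1)]) auto
  with has_cumulants_add[OF indep_vars_sum[OF insert.hyps insert.prems(1)]] insert
  show ?case by simp
qed

lemma (in prob_space) has_cumulants_shifted_moments:
  fixes c :: real
  assumes "has_cumulants M X k2 k3 k4"
  shows "has_bochner_integral M (\<lambda>\<omega>. X \<omega> + c) c"
    and "has_bochner_integral M (\<lambda>\<omega>. (X \<omega> + c) ^ 2) (k2 + c ^ 2)"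
    and "has_bochner_integral M (\<lambda>\<omega>. (X \<omega> + c) ^ 3) (k3 + 3 * c * k2 + c ^ 3)"
    and "has_bochner_integral M (\<lambda>\<omega>. (X \<omega> + c) ^ 4)
           (k4 + 3 * k2\<^sup>2 + 4 * c * k3 + 6 * c ^ 2 * k2 + c ^ 4)"
proof -
  note X = assms[unfolded has_cumulants_def]
  have const: "has_bochner_integral M (\<lambda>\<omega>. a) a" for a :: real
    by (simp add: has_bochner_integral_iff prob_space)
  have 1: "has_bochner_integral M (\<lambda>\<omega>. X \<omega> + c) (0 + c)"
    using X by (intro has_bochner_integral_add const) auto
  have 2: "has_bochner_integral M (\<lambda>\<omega>. X \<omega> ^ 2 + 2 * c * X \<omega> + c ^ 2) (k2 + 2 * c * 0 + c ^ 2)"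
    using X by (intro has_bochner_integral_add has_bochner_integral_mult_right const) auto
  have 3: "has_bochner_integral M
      (\<lambda>\<omega>. X \<omega> ^ 3 + 3 * c * X \<omega> ^ 2 + 3 * c ^ 2 * X \<omega> + c ^ 3)
      (k3 + 3 * c * k2 + 3 * c ^ 2 * 0 + c ^ 3)"
    using X by (intro has_bochner_integral_add has_bochner_integral_mult_right const) auto
  have 4: "has_bochner_integral M
      (\<lambda>\<omega>. X \<omega> ^ 4 + 4 * c * X \<omega> ^ 3 + 6 * c ^ 2 * X \<omega> ^ 2 + 4 * c ^ 3 * X \<omega> + c ^ 4)
      ((k4 + 3 * k2\<^sup>2) + 4 * c * k3 + 6 * c ^ 2 * k2 + 4 * c ^ 3 * 0 + c ^ 4)"
    using X by (intro has_bochner_integral_add has_bochner_integral_mult_right const) auto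
  show "has_bochner_integral M (\<lambda>\<omega>. X \<omega> + c) c"
    using 1 by simp
  show "has_bochner_integral M (\<lambda>\<omega>. (X \<omega> + c) ^ 2) (k2 + c ^ 2)"
    using 2 by (simp add: power2_eq_square algebra_simps)
  show "has_bochner_integral M (\<lambda>\<omega>. (X \<omega> + c) ^ 3) (k3 + 3 * c * k2 + c ^ 3)"
    using 3 by (simp add: power3_eq_cube power2_eq_square algebra_simps)
  show "has_bochner_integral M (\<lambda>\<omega>. (X \<omega> + c) ^ 4)
      (k4 + 3 * k2\<^sup>2 + 4 * c * k3 + 6 * c ^ 2 * k2 + c ^ 4)"
    using 4 by (simp add: power4_eq_xxxx power3_eq_cube power2_eq_square algebra_simps)
qed

section \<open>The two building blocks\<close>

lemma iid_rademacher_AE_sign: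
  assumes "iid_rademacher M Y"
  shows "AE \<omega> in M. \<forall>k. Y k \<omega> = 1 \<or> Y k \<omega> = - 1"
  unfolding AE_all_countable
proof
  fix k
  interpret prob_space M using assms by (simp add: iid_rademacher_def)
  have [measurable]: "Y k \<in> borel_measurable M"
    and half: "prob {\<omega> \<in> space M. Y k \<omega> = 1} = 1 / 2" "prob {\<omega> \<in> space M. Y k \<omega> = - 1} = 1 / 2"
    using assms by (auto simp: iid_rademacher_def rademacher_def)
  have "prob ({\<omega> \<in> space M. Y k \<omega> = 1} \<union> {\<omega> \<in> space M. Y k \<omega> = - 1}) = 1"
    using half by (subst finite_measure_Union) auto
  from AE_prob_1[OF this] show "AE \<omega> in M. Y k \<omega> = 1 \<or> Y k \<omega> = - 1"
    by eventually_elim auto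
qed

text \<open>Products of distinct Rademacher variables are centred. All expectations of the blocks reduce to
  this fact once squares have been replaced by 1.\<close>
lemma iid_rademacher_walsh:
  assumes "iid_rademacher M Y" "finite I" "I \<noteq> {}"
  shows "has_bochner_integral M (\<lambda>\<omega>. \<Prod>i\<in>I. Y i \<omega>) 0"
proof -
  interpret prob_space M using assms by (simp add: iid_rademacher_def)
  have mean: "has_bochner_integral M (Y k) 0" for k
  proof -
    have [measurable]: "Y k \<in> borel_measurable M"
      and half: "prob {\<omega> \<in> space M. Y k \<omega> = 1} = 1 / 2" "prob {\<omega> \<in> space M. Y k \<omega> = - 1} = 1 / 2"
      using assms by (auto simp: iid_rademacher_def rademacher_def)
    have "has_bochner_integral M (\<lambda>\<omega>. indicator {\<omega> \<in> space M. Y k \<omega> = 1} \<omega>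
        - indicator {\<omega> \<in> space M. Y k \<omega> = - 1} \<omega> :: real)
        (prob {\<omega> \<in> space M. Y k \<omega> = 1} - prob {\<omega> \<in> space M. Y k \<omega> = - 1})"
      by (intro has_bochner_integral_diff has_bochner_integral_real_indicator) (auto simp: less_top[symmetric])
    moreover have "AE \<omega> in M. indicator {\<omega> \<in> space M. Y k \<omega> = 1} \<omega>
        - indicator {\<omega> \<in> space M. Y k \<omega> = - 1} \<omega> = Y k \<omega>"
      using iid_rademacher_AE_sign[OF assms(1)] AE_space
      by eventually_elim (auto simp: indicator_def dest: spec[of _ k])
    ultimately show ?thesis
      using has_bochner_integralI_AE[of M _ _ "Y k"] by (simp add: half)
  qed
  have ind: "indep_vars (\<lambda>_. borel) Y I"
    using assms by (auto simp: iid_rademacher_def intro: indep_vars_subset)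
  have "integrable M (Y i)" "expectation (Y i) = 0" for i
    using mean[of i] by (auto simp: has_bochner_integral_iff)
  then show ?thesis
    using indep_vars_lebesgue_integral[OF assms(2) ind] indep_vars_integrable[OF assms(2) ind] assms
    by (simp add: has_bochner_integral_iff card_gt_0_iff)
qed

text \<open>A triangle \<open>Q\<close> takes only the two values \<open>3\<close> and \<open>-1\<close>, so each power of \<open>Q\<close> is almost surely
  an affine function \<open>p Q + q\<close>, and \<open>E[Q\<^sup>n] = q\<close> because \<open>E[Q] = 0\<close>. Interpolation at the two values
  gives \<open>Q\<^sup>2 = 2 Q + 3\<close>, \<open>Q\<^sup>3 = 7 Q + 6\<close>, \<open>Q\<^sup>4 = 20 Q + 21\<close>.\<close>
lemma has_cumulants_triangle:
  assumes "iid_rademacher M Y" "distinct [a, b, c]"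
  shows "has_cumulants M (Q_triangle (Y a) (Y b) (Y c)) 3 6 (- 6)"
proof -
  interpret prob_space M using assms by (simp add: iid_rademacher_def)
  have [measurable]: "Y k \<in> borel_measurable M" for k
    using assms by (auto simp: iid_rademacher_def rademacher_def)
  let ?Q = "Q_triangle (Y a) (Y b) (Y c)"
  have [measurable]: "?Q \<in> borel_measurable M"
    unfolding Q_triangle_def by measurable
  have "has_bochner_integral M (\<lambda>\<omega>. (\<Prod>i\<in>{a, b}. Y i \<omega>) + (\<Prod>i\<in>{a, c}. Y i \<omega>) + (\<Prod>i\<in>{b, c}. Y i \<omega>))
      (0 + 0 + 0)"
    using assms by (intro has_bochner_integral_add iid_rademacher_walsh) auto
  then have Q: "has_bochner_integral M ?Q 0"
    using assms(2) by (simp add: Q_triangle_def[abs_def])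
  have reduce: "AE \<omega> in M. p * ?Q \<omega> + q = ?Q \<omega> ^ n"
    if "3 * p + q = 3 ^ n" "- p + q = (- 1) ^ n" for p q :: real and n
    using iid_rademacher_AE_sign[OF assms(1)]
  proof eventually_elim
    case (elim \<omega>)
    have "?Q \<omega> = 3 \<or> ?Q \<omega> = - 1"
      using spec[OF elim, of a] spec[OF elim, of b] spec[OF elim, of c]
      by (elim disjE) (simp_all add: Q_triangle_def)
    then show ?case using that by auto
  qed
  have const: "has_bochner_integral M (\<lambda>\<omega>. r) r" for r :: real
    by (simp add: has_bochner_integral_iff prob_space)
  have affine: "has_bochner_integral M (\<lambda>\<omega>. p * ?Q \<omega> + q) q" for p q
    using has_bochner_integral_add[OF has_bochner_integral_mult_right[of p, OF Q] const[of q]]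
    by simp
  have "has_bochner_integral M (\<lambda>\<omega>. ?Q \<omega> ^ n) q"
    if "3 * p + q = 3 ^ n" "- p + q = (- 1) ^ n" for p q :: real and n
    by (rule has_bochner_integralI_AE[OF affine[of p q] _ reduce[OF that]]) measurable
  from Q this[of 2 3 2] this[of 7 6 3] this[of 20 21 4] show ?thesis
    unfolding has_cumulants_def by simp
qed

text \<open>A square \<open>R\<close> takes the values \<open>0, 4, -4\<close>, so \<open>R\<^sup>3 = 16 R\<close> and \<open>R\<^sup>4 = 16 R\<^sup>2\<close>, which reduces
  everything to the first two moments. The second follows from
  \<open>R\<^sup>2 = (\<epsilon>\<^sub>a + \<epsilon>\<^sub>c)\<^sup>2 (\<epsilon>\<^sub>b + \<epsilon>\<^sub>d)\<^sup>2 = (2 + 2 \<epsilon>\<^sub>a \<epsilon>\<^sub>c) (2 + 2 \<epsilon>\<^sub>b \<epsilon>\<^sub>d)\<close>.\<close>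
lemma has_cumulants_square:
  assumes "iid_rademacher M Y" "distinct [a, b, c, d]"
  shows "has_cumulants M (Q_square (Y a) (Y b) (Y c) (Y d)) 4 0 16"
proof -
  interpret prob_space M using assms by (simp add: iid_rademacher_def)
  have [measurable]: "Y k \<in> borel_measurable M" for k
    using assms by (auto simp: iid_rademacher_def rademacher_def)
  let ?R = "Q_square (Y a) (Y b) (Y c) (Y d)"
  have [measurable]: "?R \<in> borel_measurable M"
    unfolding Q_square_def by measurable
  have const: "has_bochner_integral M (\<lambda>\<omega>. r) r" for r :: real
    by (simp add: has_bochner_integral_iff prob_space)
  have "has_bochner_integral M (\<lambda>\<omega>. (\<Prod>i\<in>{a, b}. Y i \<omega>) + (\<Prod>i\<in>{b, c}. Y i \<omega>)
      + (\<Prod>i\<in>{c, d}. Y i \<omega>) + (\<Prod>i\<in>{d, a}. Y i \<omega>)) (0 + 0 + 0 + 0)"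
    using assms by (intro has_bochner_integral_add iid_rademacher_walsh) auto
  then have 1: "has_bochner_integral M ?R 0"
    using assms(2) by (auto simp: Q_square_def[abs_def])
  have "has_bochner_integral M (\<lambda>\<omega>. 4 + 4 * (\<Prod>i\<in>{a, c}. Y i \<omega>) + 4 * (\<Prod>i\<in>{b, d}. Y i \<omega>)
      + 4 * (\<Prod>i\<in>{a, b, c, d}. Y i \<omega>)) (4 + 4 * 0 + 4 * 0 + 4 * 0)"
    using assms
    by (intro has_bochner_integral_add has_bochner_integral_mult_right iid_rademacher_walsh const) auto
  then have *: "has_bochner_integral M
      (\<lambda>\<omega>. 4 + 4 * (Y a \<omega> * Y c \<omega>) + 4 * (Y b \<omega> * Y d \<omega>)
           + 4 * (Y a \<omega> * (Y b \<omega> * (Y c \<omega> * Y d \<omega>)))) 4"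
    using assms(2) by auto
  have "AE \<omega> in M. 4 + 4 * (Y a \<omega> * Y c \<omega>) + 4 * (Y b \<omega> * Y d \<omega>)
      + 4 * (Y a \<omega> * (Y b \<omega> * (Y c \<omega> * Y d \<omega>))) = ?R \<omega> ^ 2 \<and> 16 * ?R \<omega> = ?R \<omega> ^ 3
      \<and> 16 * ?R \<omega> ^ 2 = ?R \<omega> ^ 4"
    using iid_rademacher_AE_sign[OF assms(1)]
  proof eventually_elim
    case (elim \<omega>)
    show ?case
      using spec[OF elim, of a] spec[OF elim, of b] spec[OF elim, of c] spec[OF elim, of d]
      by (elim disjE) (simp_all add: Q_square_def)
  qed
  then have ae: "AE \<omega> in M. 4 + 4 * (Y a \<omega> * Y c \<omega>) + 4 * (Y b \<omega> * Y d \<omega>)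
      + 4 * (Y a \<omega> * (Y b \<omega> * (Y c \<omega> * Y d \<omega>))) = ?R \<omega> ^ 2"
    "AE \<omega> in M. 16 * ?R \<omega> = ?R \<omega> ^ 3" "AE \<omega> in M. 16 * ?R \<omega> ^ 2 = ?R \<omega> ^ 4"
    by auto
  have 2: "has_bochner_integral M (\<lambda>\<omega>. ?R \<omega> ^ 2) 4"
    by (rule has_bochner_integralI_AE[OF * _ ae(1)]) measurable
  have 3: "has_bochner_integral M (\<lambda>\<omega>. ?R \<omega> ^ 3) (16 * 0)"
    by (rule has_bochner_integralI_AE[OF has_bochner_integral_mult_right[OF 1] _ ae(2)]) measurable
  have 4: "has_bochner_integral M (\<lambda>\<omega>. ?R \<omega> ^ 4) (16 * 4)"
    by (rule has_bochner_integralI_AE[OF has_bochner_integral_mult_right[OF 2] _ ae(3)]) measurable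
  from 1 2 3 4 show ?thesis
    unfolding has_cumulants_def by simp
qed

section \<open>Cumulants and values of the sum of the blocks\<close>

text \<open>The blocks depend on disjoint sets of coordinates of an independent family, hence are independent,
  and their cumulants add up to \<open>4 * 3 + 3 * 4\<close>, \<open>4 * 6 + 3 * 0\<close> and \<open>4 * (-6) + 3 * 16\<close>,
  all of which are 24.\<close>
lemma has_cumulants_F_chaos:
  assumes iid: "iid_rademacher M Y" and disj: "disjoint_blocks t s"
  shows "has_cumulants M (F_chaos Y t s) 24 24 24"
proof -
  interpret prob_space M using iid by (simp add: iid_rademacher_def)
  \<comment> \<open>Blocks are labelled by a disjoint sum, triangles on the left and squares on the right; \<open>K l\<close> is
    the vertex set of block \<open>l\<close>, and \<open>B l\<close> is its quadratic form as a function of the signs alone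
    (the sample point \<open>()\<close> is a dummy).\<close>
  define L :: "(nat + nat) set" where "L = {1..4} <+> {1..3}"
  define K where "K = case_sum (\<lambda>j. t j ` {1..3}) (\<lambda>j. s j ` {1..4})"
  define B :: "nat + nat \<Rightarrow> (nat \<Rightarrow> real) \<Rightarrow> real" where
    "B = case_sum (\<lambda>j y. Q_triangle (\<lambda>_. y (t j 1)) (\<lambda>_. y (t j 2)) (\<lambda>_. y (t j 3)) ())
           (\<lambda>j y. Q_square (\<lambda>_. y (s j 1)) (\<lambda>_. y (s j 2)) (\<lambda>_. y (s j 3)) (\<lambda>_. y (s j 4)) ())"
  note distinct_ids = disjoint_blocksD[OF disj]
  have "indep_vars (\<lambda>_. borel) Y UNIV"
    using iid by (simp add: iid_rademacher_def)
  moreover have "disjoint_family_on K L"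
    unfolding disjoint_family_on_def K_def L_def
    by (auto simp: distinct_ids distinct_ids(3)[symmetric])
  ultimately have "indep_vars (\<lambda>l. PiM (K l) (\<lambda>_. borel)) (\<lambda>l \<omega>. restrict (\<lambda>i. Y i \<omega>) (K l)) L"
    by (intro indep_vars_restrict) auto
  moreover have "B l \<in> borel_measurable (PiM (K l) (\<lambda>_. borel))" if "l \<in> L" for l
  proof (cases l)
    case (Inl j)
    have [measurable]: "(\<lambda>y. y (t j i)) \<in> borel_measurable (PiM (t j ` {1..3}) (\<lambda>_. borel :: real measure))"
      if "i \<in> {1..3}" for i
      using that by (intro measurable_component_singleton) auto
    show ?thesis unfolding Inl B_def K_def Q_triangle_def by simp
  next
    case (Inr j)
    have [measurable]: "(\<lambda>y. y (s j i)) \<in> borel_measurable (PiM (s j ` {1..4}) (\<lambda>_. borel :: real measure))"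
      if "i \<in> {1..4}" for i
      using that by (intro measurable_component_singleton) auto
    show ?thesis unfolding Inr B_def K_def Q_square_def by simp
  qed
  ultimately have indep: "indep_vars (\<lambda>_. borel) (\<lambda>l \<omega>. B l (restrict (\<lambda>i. Y i \<omega>) (K l))) L"
    by (rule indep_vars_compose2)
  have tri: "(\<lambda>\<omega>. B (Inl j) (restrict (\<lambda>i. Y i \<omega>) (K (Inl j)))) = Q_triangle (Y (t j 1)) (Y (t j 2)) (Y (t j 3))"
    for j by (simp add: B_def K_def Q_triangle_def fun_eq_iff)
  have sq: "(\<lambda>\<omega>. B (Inr j) (restrict (\<lambda>i. Y i \<omega>) (K (Inr j))))
      = Q_square (Y (s j 1)) (Y (s j 2)) (Y (s j 3)) (Y (s j 4))"
    for j by (simp add: B_def K_def Q_square_def fun_eq_iff)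
  have "has_cumulants M (\<lambda>\<omega>. \<Sum>l\<in>L. B l (restrict (\<lambda>i. Y i \<omega>) (K l)))
      (\<Sum>l\<in>L. case_sum (\<lambda>_. 3) (\<lambda>_. 4) l) (\<Sum>l\<in>L. case_sum (\<lambda>_. 6) (\<lambda>_. 0) l)
      (\<Sum>l\<in>L. case_sum (\<lambda>_. - 6) (\<lambda>_. 16) l)"
  proof (rule has_cumulants_sum[OF _ indep])
    fix l assume "l \<in> L"
    then show "has_cumulants M (\<lambda>\<omega>. B l (restrict (\<lambda>i. Y i \<omega>) (K l)))
        (case_sum (\<lambda>_. 3) (\<lambda>_. 4) l) (case_sum (\<lambda>_. 6) (\<lambda>_. 0) l) (case_sum (\<lambda>_. - 6) (\<lambda>_. 16) l)"
      unfolding L_def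
    proof (elim PlusE)
      fix j :: nat assume "l = Inl j" "j \<in> {1..4}"
      then show ?thesis
        using distinct_ids(1)[of j j] by (simp add: tri has_cumulants_triangle[OF iid])
    next
      fix j :: nat assume "l = Inr j" "j \<in> {1..3}"
      then show ?thesis
        using distinct_ids(2)[of j j] by (simp add: sq has_cumulants_square[OF iid])
    qed
  qed (simp add: L_def)
  moreover have "(\<Sum>l\<in>L. B l (restrict (\<lambda>i. Y i \<omega>) (K l))) = F_chaos Y t s \<omega>" for \<omega>
    using fun_cong[OF tri, of _ \<omega>] fun_cong[OF sq, of _ \<omega>]
    by (simp add: L_def sum.Plus F_chaos_def)
  ultimately show ?thesis
    by (simp add: L_def sum.Plus)
qed

text \<open>Each triangle is \<open>4 a - 1\<close> and each square \<open>4 b - 4\<close> with natural \<open>a\<close>, \<open>b\<close>, so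
  \<open>F + 24 = 4 (\<Sum>a + \<Sum>b) - 4 - 12 + 24\<close>, and what remains of the constant is \<open>8 \<ge> 0\<close>.\<close>
lemma F_chaos_lattice:
  assumes sign: "\<And>k. Y k \<omega> = 1 \<or> Y k \<omega> = - 1"
  obtains n :: nat where "F_chaos Y t s \<omega> + 24 = 2 * real n"
proof -
  have "\<exists>a::nat. Q_triangle (Y i) (Y j) (Y k) \<omega> = 4 * real a - 1" for i j k
  proof -
    have "Q_triangle (Y i) (Y j) (Y k) \<omega> \<in> {4 * real 1 - 1, 4 * real 0 - 1}"
      using sign[of i] sign[of j] sign[of k] by (auto simp: Q_triangle_def)
    then show ?thesis by blast
  qed
  then obtain a where a: "\<And>i j k. Q_triangle (Y i) (Y j) (Y k) \<omega> = 4 * real (a i j k) - 1"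
    by metis
  have "\<exists>b::nat. Q_square (Y h) (Y i) (Y j) (Y k) \<omega> = 4 * real b - 4" for h i j k
  proof -
    have "Q_square (Y h) (Y i) (Y j) (Y k) \<omega> \<in> {4 * real 0 - 4, 4 * real 1 - 4, 4 * real 2 - 4}"
      using sign[of h] sign[of i] sign[of j] sign[of k] by (auto simp: Q_square_def)
    then show ?thesis by blast
  qed
  then obtain b where b: "\<And>h i j k. Q_square (Y h) (Y i) (Y j) (Y k) \<omega> = 4 * real (b h i j k) - 4"
    by metis
  show thesis
    by (rule that[of "2 * (\<Sum>j = 1..4. a (t j 1) (t j 2) (t j 3))
          + 2 * (\<Sum>j = 1..3. b (s j 1) (s j 2) (s j 3) (s j 4)) + 4"])
      (simp add: F_chaos_def a b sum_subtractf sum_distrib_left[symmetric])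
qed

section \<open>Poisson moments and parity\<close>

lemma has_bochner_integral_count_space_nat_iff:
  fixes g :: "nat \<Rightarrow> real"
  shows "has_bochner_integral (count_space UNIV) g x \<longleftrightarrow> summable (\<lambda>n. \<bar>g n\<bar>) \<and> g sums x"
  using sums_integral_count_space_nat[of g]
  by (auto simp: has_bochner_integral_iff integrable_count_space_nat_iff dest: sums_unique2)

lemma has_bochner_integral_poisson_iff:
  fixes g :: "nat \<Rightarrow> real"
  assumes "lam > 0"
  shows "has_bochner_integral (measure_pmf (poisson_pmf lam)) g x \<longleftrightarrow>
    summable (\<lambda>n. lam ^ n / fact n * exp (- lam) * \<bar>g n\<bar>) \<and>
    (\<lambda>n. lam ^ n / fact n * exp (- lam) * g n) sums x"
  using assms has_bochner_integral_count_space_nat_iff[of "\<lambda>n. pmf (poisson_pmf lam) n * g n" x]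
  by (simp add: measure_pmf_eq_density has_bochner_integral_iff integrable_density integral_density
      abs_mult)

text \<open>The weights satisfy \<open>(n + 1) p(n + 1) = lam p(n)\<close>, so the series for \<open>E[n g(n)]\<close>, whose term at 0
  vanishes, is \<open>lam\<close> times the series for \<open>E[g(n + 1)]\<close>.\<close>
lemma poisson_stein_chen:
  fixes g :: "nat \<Rightarrow> real"
  assumes "lam > 0" and g: "has_bochner_integral (measure_pmf (poisson_pmf lam)) (\<lambda>n. g (Suc n)) x"
  shows "has_bochner_integral (measure_pmf (poisson_pmf lam)) (\<lambda>n. real n * g n) (lam * x)"
proof -
  let ?p = "\<lambda>n. lam ^ n / fact n * exp (- lam)"
  have shift: "?p (Suc n) * (real (Suc n) * r) = lam * (?p n * r)" for n r
    by (simp add: divide_simps del: of_nat_Suc)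
  note g' = g[unfolded has_bochner_integral_poisson_iff[OF assms(1)]]
  have "summable (\<lambda>n. lam * (?p n * \<bar>g (Suc n)\<bar>))"
    and sums: "(\<lambda>n. lam * (?p n * g (Suc n))) sums (lam * x)"
    by (rule summable_mult sums_mult g'[THEN conjunct1] g'[THEN conjunct2])+
  then have "summable (\<lambda>n. ?p (Suc n) * \<bar>real (Suc n) * g (Suc n)\<bar>)"
    by (simp only: abs_mult abs_of_nat shift)
  moreover have "(\<lambda>n. ?p (Suc n) * (real (Suc n) * g (Suc n))) sums (lam * x)"
    using sums by (simp only: shift)
  ultimately show ?thesis
    unfolding has_bochner_integral_poisson_iff[OF assms(1)]
    using summable_Suc_iff[of "\<lambda>n. ?p n * \<bar>real n * g n\<bar>"]
      sums_Suc_iff[of "\<lambda>n. ?p n * (real n * g n)" "lam * x"]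
    by simp
qed

text \<open>With \<open>g(n) = n\<^sup>k\<close> the preceding identity reads \<open>E[P\<^bsup>k+1\<^esup>] = lam E[(P + 1)\<^sup>k]\<close>, a recursion for the
  moments.\<close>
lemma poisson_moments:
  assumes "lam > 0"
  defines "Po \<equiv> measure_pmf (poisson_pmf lam)"
  shows "has_bochner_integral Po (\<lambda>n. real n) lam"
    and "has_bochner_integral Po (\<lambda>n. real n ^ 2) (lam ^ 2 + lam)"
    and "has_bochner_integral Po (\<lambda>n. real n ^ 3) (lam ^ 3 + 3 * lam ^ 2 + lam)"
    and "has_bochner_integral Po (\<lambda>n. real n ^ 4) (lam ^ 4 + 6 * lam ^ 3 + 7 * lam ^ 2 + lam)"
proof -
  note step = poisson_stein_chen[OF assms(1), folded Po_def]
  note add = has_bochner_integral_add and scale = has_bochner_integral_mult_right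
  have 0: "has_bochner_integral Po (\<lambda>n. 1) (1 :: real)"
    by (simp add: Po_def has_bochner_integral_iff)
  show 1: "has_bochner_integral Po (\<lambda>n. real n) lam"
    using step[of "\<lambda>_. 1" 1] 0 by simp
  have "has_bochner_integral Po (\<lambda>n. real (Suc n)) (lam + 1)"
    using add[OF 1 0] by (simp add: add.commute)
  from step[OF this] show 2: "has_bochner_integral Po (\<lambda>n. real n ^ 2) (lam ^ 2 + lam)"
    by (simp add: power2_eq_square algebra_simps)
  have "has_bochner_integral Po (\<lambda>n. real (Suc n) ^ 2) ((lam ^ 2 + lam) + 2 * lam + 1)"
    using add[OF add[OF 2 scale[OF 1, of 2]] 0] by (simp add: power2_eq_square algebra_simps)
  from step[OF this] show 3: "has_bochner_integral Po (\<lambda>n. real n ^ 3) (lam ^ 3 + 3 * lam ^ 2 + lam)"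
    by (simp add: power3_eq_cube power2_eq_square algebra_simps)
  have "has_bochner_integral Po (\<lambda>n. real (Suc n) ^ 3)
      ((lam ^ 3 + 3 * lam ^ 2 + lam) + 3 * (lam ^ 2 + lam) + 3 * lam + 1)"
    using add[OF add[OF add[OF 3 scale[OF 2, of 3]] scale[OF 1, of 3]] 0]
    by (simp add: power3_eq_cube power2_eq_square algebra_simps)
  from step[OF this]
  show "has_bochner_integral Po (\<lambda>n. real n ^ 4) (lam ^ 4 + 6 * lam ^ 3 + 7 * lam ^ 2 + lam)"
    by (simp add: power4_eq_xxxx power3_eq_cube power2_eq_square algebra_simps)
qed

text \<open>The indicator of the even numbers is \<open>(1 + (-1)\<^sup>n) / 2\<close>, and \<open>E[(-1)\<^sup>P]\<close> is the probability
  generating function at \<open>-1\<close>, that is \<open>exp (- lam) exp (- lam)\<close>.\<close>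
lemma poisson_prob_even:
  assumes "lam > 0"
  shows "measure (measure_pmf (poisson_pmf lam)) {n. even n} = (1 + exp (- 2 * lam)) / 2"
proof -
  let ?Po = "measure_pmf (poisson_pmf lam)"
  have "summable (\<lambda>n. lam ^ n / fact n * exp (- lam) * \<bar>(- 1) ^ n\<bar>)"
    using summable_mult2[OF summable_exp[of lam], of "exp (- lam)"]
    by (simp add: field_simps power_abs)
  moreover have "(\<lambda>n. lam ^ n / fact n * exp (- lam) * (- 1) ^ n) sums (exp (- 2 * lam))"
    using sums_mult2[OF exp_converges[of "- lam"], of "exp (- lam)"]
    by (simp add: field_simps power_minus[of lam] exp_add[symmetric] scaleR_conv_of_real)
  ultimately have "has_bochner_integral ?Po (\<lambda>n. (- 1) ^ n) (exp (- 2 * lam))"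
    by (simp add: has_bochner_integral_poisson_iff[OF assms])
  then have "has_bochner_integral ?Po (\<lambda>n. (1 + (- 1) ^ n) / 2) ((1 + exp (- 2 * lam)) / 2)"
    by (intro has_bochner_integral_divide has_bochner_integral_add) (auto simp: has_bochner_integral_iff)
  moreover have "(\<lambda>n::nat. (1 + (- 1) ^ n) / 2 :: real) = indicator {n. even n}"
    by (auto simp: fun_eq_iff indicator_def)
  ultimately show ?thesis
    by (simp add: has_bochner_integral_iff)
qed

section \<open>Comparison with the Poisson law\<close>

text \<open>A supremum of reals bounds its members only if it is taken over a bounded set; here the
  differences of probabilities are at most 1.\<close>
lemma d_TV_ge:
  assumes "prob_space M" "prob_space N" "A \<subseteq> \<nat>"
  shows "\<bar>measure M {\<omega> \<in> space M. X \<omega> \<in> A} - measure N {\<omega> \<in> space N. Z \<omega> \<in> A}\<bar> \<le> d_TV M X N Z"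
  unfolding d_TV_def
proof (rule cSUP_upper)
  have "\<bar>measure M B - measure N C\<bar> \<le> 1" for B C
    using prob_space.prob_le_1[OF assms(1), of B] prob_space.prob_le_1[OF assms(2), of C]
      measure_nonneg[of M B] measure_nonneg[of N C] by linarith
  then show "bdd_above ((\<lambda>A. \<bar>measure M {\<omega> \<in> space M. X \<omega> \<in> A} -
      measure N {\<omega> \<in> space N. Z \<omega> \<in> A}\<bar>) ` Pow \<nat>)"
    by (intro bdd_aboveI2)
qed (use assms in auto)

theorem proposition4p1:
  fixes M :: "'w measure" and Y :: "nat \<Rightarrow> 'w \<Rightarrow> real"
    and t s :: "nat \<Rightarrow> nat \<Rightarrow> nat"
    and N :: "'v measure" and P24 :: "'v \<Rightarrow> nat"
    and F :: "'w \<Rightarrow> real"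
  assumes "iid_rademacher M Y"
    and "disjoint_blocks t s"
    and "poisson_distributed N P24 24"
    and "F = F_chaos Y t s"
  shows "F \<in> second_rademacher_chaos M Y \<and>
    (AE \<omega> in M. (F \<omega> + 24) / 2 \<in> \<nat>) \<and>
    (\<forall>k\<in>{1..4::nat}.
       integrable M (\<lambda>\<omega>. (F \<omega> + 24) ^ k) \<and>
       integrable N (\<lambda>\<omega>. real (P24 \<omega>) ^ k) \<and>
       (\<integral>\<omega>. (F \<omega> + 24) ^ k \<partial>M) = (\<integral>\<omega>. real (P24 \<omega>) ^ k \<partial>N)) \<and>
    d_TV M (\<lambda>\<omega>. F \<omega> + 24) N (\<lambda>\<omega>. real (P24 \<omega>)) \<ge> (1 - exp (-48)) / 2"
proof -
  interpret prob_space M using assms(1) by (simp add: iid_rademacher_def)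
  interpret N: prob_space N using assms(3) by (simp add: poisson_distributed_def)
  have Y: "Y k \<in> borel_measurable M" for k
    using assms(1) by (auto simp: iid_rademacher_def rademacher_def)
  have chaos: "F \<in> second_rademacher_chaos M Y"
    unfolding assms(4) using Y assms(2) by (rule F_chaos_in_chaos)
  then have [measurable]: "F \<in> borel_measurable M"
    by (simp add: second_rademacher_chaos_def)
  have [measurable]: "P24 \<in> measurable N (count_space UNIV)"
    and law: "distr N (count_space UNIV) P24 = measure_pmf (poisson_pmf 24)"
    using assms(3) by (auto simp: poisson_distributed_def)

  have even: "AE \<omega> in M. F \<omega> + 24 \<in> range (\<lambda>n::nat. 2 * real n)"
    using iid_rademacher_AE_sign[OF assms(1)]
  proof eventually_elim
    case (elim \<omega>)
    then show ?case unfolding assms(4) using F_chaos_lattice[of Y \<omega> t s] by blast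
  qed
  then have lattice: "AE \<omega> in M. (F \<omega> + 24) / 2 \<in> \<nat>"
    by eventually_elim auto

  have transfer: "has_bochner_integral N (\<lambda>\<omega>. g (P24 \<omega>)) x"
    if "has_bochner_integral (measure_pmf (poisson_pmf 24)) g x" for g :: "nat \<Rightarrow> real" and x
    using that unfolding law[symmetric]
    by (simp add: has_bochner_integral_iff integrable_distr_eq integral_distr)
  have F24: "has_cumulants M F 24 24 24"
    unfolding assms(4) using assms(1,2) by (rule has_cumulants_F_chaos)
  \<comment> \<open>For \<open>c = lam\<close> and all cumulants equal to \<open>lam\<close>, the shifted moments are polynomials in \<open>lam\<close>
    identical to the Poisson moments; at \<open>lam = 24\<close> both sides are evaluated numerically.\<close>
  have same: "\<exists>m. has_bochner_integral M (\<lambda>\<omega>. (F \<omega> + 24) ^ k) m \<and>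
      has_bochner_integral N (\<lambda>\<omega>. real (P24 \<omega>) ^ k) m" if "k \<in> {1..4}" for k
  proof -
    from that consider "k = 1" | "k = 2" | "k = 3" | "k = 4"
      by force
    then show ?thesis
      using has_cumulants_shifted_moments[OF F24, of 24] poisson_moments[of 24, THEN transfer]
      by cases (simp_all, blast+)
  qed
  have moments: "\<forall>k\<in>{1..4::nat}.
       integrable M (\<lambda>\<omega>. (F \<omega> + 24) ^ k) \<and>
       integrable N (\<lambda>\<omega>. real (P24 \<omega>) ^ k) \<and>
       (\<integral>\<omega>. (F \<omega> + 24) ^ k \<partial>M) = (\<integral>\<omega>. real (P24 \<omega>) ^ k \<partial>N)"
    using same by (fastforce simp: has_bochner_integral_iff)

  let ?A = "range (\<lambda>n::nat. 2 * real n)"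
  have A: "?A \<subseteq> \<nat>" by auto
  have [measurable]: "?A \<in> sets borel"
    by (rule sets.countable) simp_all
  have "prob {\<omega> \<in> space M. F \<omega> + 24 \<in> ?A} = 1"
    using even by (subst prob_eq_1) (auto elim!: eventually_mono)
  moreover have "{\<omega> \<in> space N. real (P24 \<omega>) \<in> ?A} = P24 -` {n. even n} \<inter> space N"
  proof -
    have "real m \<in> ?A \<longleftrightarrow> even m" for m
    proof -
      have "real m = 2 * real n \<longleftrightarrow> m = 2 * n" for n
        by linarith
      then show ?thesis by (simp add: image_iff dvd_def)
    qed
    then show ?thesis by blast
  qed
  then have "measure N {\<omega> \<in> space N. real (P24 \<omega>) \<in> ?A} = (1 + exp (- 48)) / 2"
    using measure_distr[of P24 N "count_space UNIV" "{n. even n}"] poisson_prob_even[of 24]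
    by (simp add: law)
  moreover have "\<bar>1 - (1 + exp (- 48)) / 2\<bar> \<ge> (1 - exp (- 48)) / (2 :: real)"
    by (simp add: field_simps)
  ultimately have "d_TV M (\<lambda>\<omega>. F \<omega> + 24) N (\<lambda>\<omega>. real (P24 \<omega>)) \<ge> (1 - exp (-48)) / 2"
    using d_TV_ge[OF prob_space_axioms N.prob_space_axioms A, of "\<lambda>\<omega>. F \<omega> + 24" "\<lambda>\<omega>. real (P24 \<omega>)"]
    by simp
  with chaos lattice moments show ?thesis by blast
qed

end
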